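(* Let $n \geq 1$ and let $\Delta$ be a color-shifted, $n$-colored simplicial complex (with colors $[n]=\{1,\dots,n\}$). Then there exist an integer $m$ and an $m$-colored simplicial complex $\Gamma$ (with colors $[m]=\{1,\dots,m\}$) such that (1) the color-selected subcomplex of $\Gamma$ for the color set $[n]$ is $\Delta$, and (2) $\Gamma$ is color-shifted, and every color-shifted $m$-colored simplicial complex $\Sigma$ with $f_S(\Sigma)=f_S(\Gamma)$ for all $S\subset[m]$ satisfies $\Sigma=\Gamma$.
   Context: A simplicial complex $\Delta$ on a vertex set $W$ is a collection of subsets of $W$ (faces) such that $\{v\}\in\Delta$ for every $v\in W$ and $\Delta$ is closed under taking subsets. An $n$-coloring assigns to each vertex a color in $[n]$ so that no two vertices of a face share a color; an $n$-colored complex is a complex with such a coloring. The color set of a face is the set of colors of its vertices. For $S\subset[n]$, the flag f-number $f_S(\Delta)$ is the number of faces of $\Delta$ with color set $S$; the flag f-vector $f(\Delta)$ is the collection of all $f_S(\Delta)$. For each color $i$, the vertices of color $i$ are given a fixed order and labeled $v^i_1, v^i_2,\dots,v^i_{f_{\{i\}}(\Delta)}$. The complex is color-shifted if whenever $\{v^{i_1}_{a_1},\dots,v^{i_j}_{a_j}\}\in\Delta$ (distinct colors $i_1,\dots,i_j$) and $b_1\le a_1,\dots,b_j\le a_j$ (positive integers), also $\{v^{i_1}_{b_1},\dots,v^{i_j}_{b_j}\}\in\Delta$. For $S\subset[n]$, the color-selected subcomplex of $\Delta$ for $S$ is the subcomplex consisting of all faces of $\Delta$ whose color set is a subset of $S$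 (with the same coloring and vertex labeling). *)

theory Defs
  imports Main
begin

definition simplicial_complex :: "'v set \<Rightarrow> 'v set set \<Rightarrow> bool" where
  "simplicial_complex W \<Delta> \<longleftrightarrow>
     finite W \<and>
     (\<forall>F\<in>\<Delta>. F \<subseteq> W) \<and>
     (\<forall>v\<in>W. {v} \<in> \<Delta>) \<and>
     (\<forall>F\<in>\<Delta>. \<forall>G. G \<subseteq> F \<longrightarrow> G \<in> \<Delta>)"

definition coloring :: "nat \<Rightarrow> ('v \<Rightarrow> nat) \<Rightarrow> 'v set \<Rightarrow> 'v set set \<Rightarrow> bool" where
  "coloring n c W \<Delta> \<longleftrightarrow>
     (\<forall>v\<in>W. c v \<in> {1..n}) \<and>
     (\<forall>F\<in>\<Delta>. \<forall>v\<in>F. \<forall>w\<in>F. v \<noteq> w \<longrightarrow> c v \<noteq> c w)"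

text \<open>The vertex \<open>v\<^sup>i\<^sub>a\<close>, i.e. the \<open>a\<close>-th vertex of color \<open>i\<close>, is the pair \<open>(i, a)\<close>, with
  \<open>a\<close> counted from 1. A colored complex with labeled vertices is thus a set of faces over such
  pairs, and equality of these sets is equality of complexes including coloring and labeling.\<close>

type_synonym vertex = "nat \<times> nat"

abbreviation color :: "vertex \<Rightarrow> nat" where
  "color \<equiv> fst"

definition color_set :: "vertex set \<Rightarrow> nat set" where
  "color_set F = color ` F"

definition flag_f :: "vertex set set \<Rightarrow> nat set \<Rightarrow> nat" where
  "flag_f \<Delta> S = card {F \<in> \<Delta>. color_set F = S}"

text \<open>The vertex set of a complex is necessarily the union of its faces. The last conjunct
  says that the vertices of color \<open>i\<close> are labeled \<open>v\<^sup>i\<^sub>1, \<dots>, v\<^sup>i\<^sub>k\<close>, where \<open>k\<close> is the flag f-number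
  of \<open>{i}\<close>.\<close>

definition colored_complex :: "nat \<Rightarrow> vertex set set \<Rightarrow> bool" where
  "colored_complex n \<Delta> \<longleftrightarrow>
     simplicial_complex (\<Union>\<Delta>) \<Delta> \<and>
     coloring n color (\<Union>\<Delta>) \<Delta> \<and>
     (\<forall>i\<in>{1..n}. {v \<in> \<Union>\<Delta>. color v = i} = {(i, a) | a. 1 \<le> a \<and> a \<le> flag_f \<Delta> {i}})"

text \<open>A face with color set \<open>I\<close> is given by the function \<open>a\<close> sending each color in \<open>I\<close> to the
  label of the vertex of that color.\<close>

definition color_shifted :: "vertex set set \<Rightarrow> bool" where
  "color_shifted \<Delta> \<longleftrightarrow>
     (\<forall>I a b. {(i, a i) | i. i \<in> I} \<in> \<Delta> \<longrightarrow> (\<forall>i\<in>I. 1 \<le> b i \<and> b i \<le> a i)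
        \<longrightarrow> {(i, b i) | i. i \<in> I} \<in> \<Delta>)"

definition color_selected :: "nat set \<Rightarrow> vertex set set \<Rightarrow> vertex set set" where
  "color_selected S \<Delta> = {F \<in> \<Delta>. color_set F \<subseteq> S}"

end

theory Submission
  imports Defs
begin

text \<open>For every face \<open>F\<close> of \<open>\<Delta>\<close> add a new color \<open>j\<close> and cone \<open>F\<close> with a single vertex of that
  color; \<open>\<Gamma>\<close> consists of all faces obtained from these cones by lowering labels and deleting
  vertices. In a color-shifted complex the vertices of color \<open>i\<close> adjacent to the only vertex of
  color \<open>j\<close> form an initial segment of length \<open>f\<^bsub>{i,j}\<^esub>\<close>. So if \<open>\<Sigma>\<close> is color-shifted with the flag
  f-vector of \<open>\<Gamma>\<close>, then a face of \<open>\<Sigma>\<close> with a vertex of color \<open>j\<close> has all its edges to that vertex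
  in \<open>\<Gamma>\<close>, and therefore lies below the cone over \<open>F\<close>. Counting the faces with the color set of that
  cone, the cone itself lies in \<open>\<Sigma>\<close>. Hence \<open>\<Gamma> \<subseteq> \<Sigma>\<close>, and equality follows by counting again.\<close>

definition colored_face :: "vertex set \<Rightarrow> bool" where
  "colored_face F \<longleftrightarrow> inj_on color F \<and> (\<forall>(i, a)\<in>F. 1 \<le> a)"

definition lowerings :: "vertex set \<Rightarrow> vertex set set" where
  "lowerings F = {G. colored_face G \<and> (\<forall>(i, a)\<in>G. \<exists>b\<ge>a. (i, b) \<in> F)}"

definition shifted_complex :: "nat \<Rightarrow> vertex set set \<Rightarrow> bool" where
  "shifted_complex m \<Delta> \<longleftrightarrow>
     finite \<Delta> \<and> (\<forall>F\<in>\<Delta>. colored_face F \<and> color_set F \<subseteq> {1..m} \<and> lowerings F \<subseteq> \<Delta>)"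

lemma color_set_insert [simp]: "color_set (insert v F) = insert (color v) (color_set F)"
  by (simp add: color_set_def)

lemma color_set_empty [simp]: "color_set {} = {}"
  by (simp add: color_set_def)

lemma in_color_setI: "(i, a) \<in> F \<Longrightarrow> i \<in> color_set F"
  unfolding color_set_def by force

lemma in_color_setE:
  assumes "i \<in> color_set F"
  obtains a where "(i, a) \<in> F"
  using assms unfolding color_set_def by force

lemma colored_face_label_pos: "colored_face F \<Longrightarrow> (i, a) \<in> F \<Longrightarrow> 1 \<le> a"
  unfolding colored_face_def by blast

lemma colored_face_label_unique:
  assumes "colored_face F" "(i, a) \<in> F" "(i, b) \<in> F"
  shows "a = b"
  using assms inj_onD[of color F "(i, a)" "(i, b)"] unfolding colored_face_def by simp

lemma colored_face_subset: "colored_face F \<Longrightarrow> G \<subseteq> F \<Longrightarrow> colored_face G"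
  unfolding colored_face_def by (blast intro: inj_on_subset)

lemma colored_face_insert:
  assumes "colored_face F" "i \<notin> color_set F" "1 \<le> a"
  shows "colored_face (insert (i, a) F)"
  using assms unfolding colored_face_def color_set_def by auto

lemma colored_face_subset_eq:
  assumes "colored_face F" "G \<subseteq> F" "color_set F = color_set G"
  shows "F = G"
  using assms inj_on_image_eq_iff[of color F F G] unfolding colored_face_def color_set_def by blast

lemma finite_colored_face:
  assumes "colored_face F" "finite (color_set F)"
  shows "finite F"
  using assms unfolding colored_face_def color_set_def by (blast intro: finite_imageD)

lemma colored_face_eq_graph:
  assumes "colored_face F"
  obtains a where "F = {(i, a i) |i. i \<in> color_set F}"
proof -
  have "\<forall>i\<in>color_set F. \<exists>x. (i, x) \<in> F" by (blast elim: in_color_setE)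
  then obtain a where a: "\<And>i. i \<in> color_set F \<Longrightarrow> (i, a i) \<in> F" by metis
  have "x = a i" if "(i, x) \<in> F" for i x
    using that a colored_face_label_unique[OF assms] in_color_setI by blast
  then have "F = {(i, a i) |i. i \<in> color_set F}"
    using a in_color_setI by auto
  then show ?thesis by (rule that)
qed

lemma lowerings_colored_face: "G \<in> lowerings F \<Longrightarrow> colored_face G"
  unfolding lowerings_def by blast

lemma lowerings_obtain_label:
  assumes "G \<in> lowerings F" "(i, a) \<in> G"
  obtains b where "a \<le> b" "(i, b) \<in> F"
  using assms unfolding lowerings_def by auto

lemma lowerings_color_set:
  assumes "G \<in> lowerings F"
  shows "color_set G \<subseteq> color_set F"
proof
  fix i assume "i \<in> color_set G"
  then obtain a where "(i, a) \<in> G" by (rule in_color_setE)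
  with assms obtain b where "(i, b) \<in> F" by (rule lowerings_obtain_label)
  then show "i \<in> color_set F" by (rule in_color_setI)
qed

lemma subset_in_lowerings: "colored_face F \<Longrightarrow> G \<subseteq> F \<Longrightarrow> G \<in> lowerings F"
  unfolding lowerings_def by (auto intro: colored_face_subset)

lemma lowerings_mono: "F \<subseteq> F' \<Longrightarrow> lowerings F \<subseteq> lowerings F'"
  unfolding lowerings_def by blast

lemma lowerings_trans:
  assumes "H \<in> lowerings G" "G \<in> lowerings F"
  shows "H \<in> lowerings F"
proof -
  have "\<exists>c\<ge>a. (i, c) \<in> F" if "(i, a) \<in> H" for i a
    using assms(1) that
  proof (rule lowerings_obtain_label)
    fix b assume "a \<le> b" "(i, b) \<in> G"
    moreover obtain c where "b \<le> c" "(i, c) \<in> F"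
      using assms(2) \<open>(i, b) \<in> G\<close> by (rule lowerings_obtain_label)
    ultimately show ?thesis using order_trans by blast
  qed
  then show ?thesis using assms(1) unfolding lowerings_def by auto
qed

lemma lowerings_insert_other_color:
  assumes "i \<notin> color_set G"
  shows "G \<in> lowerings (insert (i, a) F) \<longleftrightarrow> G \<in> lowerings F"
  using assms in_color_setI unfolding lowerings_def by fastforce

lemma finite_lowerings:
  assumes "finite F"
  shows "finite (lowerings F)"
proof (rule finite_subset)
  show "lowerings F \<subseteq> Pow (\<Union>(i, b)\<in>F. {i} \<times> {..b})"
    unfolding lowerings_def by fast
  show "finite (Pow (\<Union>(i, b)\<in>F. {i} \<times> {..b}))"
    using assms by auto
qed

lemma shifted_complexD:
  assumes "shifted_complex m \<Delta>" "F \<in> \<Delta>"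
  shows "colored_face F" "color_set F \<subseteq> {1..m}" "G \<in> lowerings F \<Longrightarrow> G \<in> \<Delta>"
  using assms unfolding shifted_complex_def by auto

lemma shifted_complex_finite: "shifted_complex m \<Delta> \<Longrightarrow> finite \<Delta>"
  unfolding shifted_complex_def by blast

lemma shifted_complex_subset:
  assumes "shifted_complex m \<Delta>" "F \<in> \<Delta>" "G \<subseteq> F"
  shows "G \<in> \<Delta>"
  using subset_in_lowerings[OF shifted_complexD(1)[OF assms(1,2)] assms(3)]
  by (rule shifted_complexD(3)[OF assms(1,2)])

lemma shifted_complex_UN_lowerings:
  assumes "shifted_complex m \<Delta>"
  shows "(\<Union>F\<in>\<Delta>. lowerings F) = \<Delta>"
proof
  show "(\<Union>F\<in>\<Delta>. lowerings F) \<subseteq> \<Delta>"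
    using shifted_complexD(3)[OF assms] by blast
  show "\<Delta> \<subseteq> (\<Union>F\<in>\<Delta>. lowerings F)"
    using shifted_complexD(1)[OF assms] subset_in_lowerings[OF _ subset_refl] by blast
qed

lemma shifted_complex_lowerings:
  assumes "finite F" "color_set F \<subseteq> {1..m}"
  shows "shifted_complex m (lowerings F)"
  unfolding shifted_complex_def
proof (intro conjI ballI)
  show "finite (lowerings F)" using assms(1) by (rule finite_lowerings)
  fix G assume G: "G \<in> lowerings F"
  then show "colored_face G" by (rule lowerings_colored_face)
  show "color_set G \<subseteq> {1..m}" using lowerings_color_set[OF G] assms(2) by (rule order_trans)
  show "lowerings G \<subseteq> lowerings F" using lowerings_trans[OF _ G] by blast
qed

lemma shifted_complex_UN:
  assumes "finite J" "\<And>j. j \<in> J \<Longrightarrow> shifted_complex m (\<Delta> j)"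
  shows "shifted_complex m (\<Union>j\<in>J. \<Delta> j)"
  using assms unfolding shifted_complex_def by blast

lemma down_closed_eq_atLeastAtMost_card:
  fixes A :: "nat set"
  assumes "finite A" "\<And>a. a \<in> A \<Longrightarrow> 1 \<le> a"
    and "\<And>a b. a \<in> A \<Longrightarrow> 1 \<le> b \<Longrightarrow> b \<le> a \<Longrightarrow> b \<in> A"
  shows "A = {1..card A}"
proof (cases "A = {}")
  case False
  have "A \<subseteq> {1..Max A}" using assms(2) Max_ge[OF assms(1)] by auto
  moreover have "{1..Max A} \<subseteq> A" using assms(3)[OF Max_in[OF assms(1) False]] by auto
  ultimately have "A = {1..Max A}" by (rule subset_antisym)
  then show ?thesis by (metis card_atLeastAtMost diff_Suc_1)
qed simp

lemma faces_color_set_insert_eq_image: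
  assumes \<Delta>: "shifted_complex m \<Delta>"
    and T: "\<And>F. F \<in> \<Delta> \<Longrightarrow> color_set F = insert i (color_set T) \<Longrightarrow> T \<subseteq> F"
  shows "{F \<in> \<Delta>. color_set F = insert i (color_set T)} =
    (\<lambda>a. insert (i, a) T) ` {a. insert (i, a) T \<in> \<Delta>}"
    (is "?faces = ?image")
proof
  show "?faces \<subseteq> ?image"
  proof
    fix F assume "F \<in> ?faces"
    then have F: "F \<in> \<Delta>" "color_set F = insert i (color_set T)" by auto
    then obtain a where "(i, a) \<in> F" by (blast elim: in_color_setE)
    then have "F = insert (i, a) T"
      using F T[OF F] shifted_complexD(1)[OF \<Delta> F(1)] by (intro colored_face_subset_eq) auto
    then show "F \<in> ?image" using F(1) by blast
  qed
qed auto

lemma insert_vertex_mem_iff_le_flag_f: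
  assumes \<Delta>: "shifted_complex m \<Delta>"
    and i: "i \<notin> color_set T"
    and T: "\<And>F. F \<in> \<Delta> \<Longrightarrow> color_set F = insert i (color_set T) \<Longrightarrow> T \<subseteq> F"
  shows "insert (i, a) T \<in> \<Delta> \<longleftrightarrow> a \<in> {1..flag_f \<Delta> (insert i (color_set T))}"
proof -
  define A where "A = {a. insert (i, a) T \<in> \<Delta>}"
  have faces: "{F \<in> \<Delta>. color_set F = insert i (color_set T)} = (\<lambda>a. insert (i, a) T) ` A"
    unfolding A_def using \<Delta> T by (rule faces_color_set_insert_eq_image)
  have inj: "inj_on (\<lambda>a. insert (i, a) T) A"
    using i in_color_setI by (intro inj_onI) blast
  have "A = {1..card A}"
  proof (rule down_closed_eq_atLeastAtMost_card)
    show "finite A"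
      using finite_imageD[OF _ inj] shifted_complex_finite[OF \<Delta>] unfolding faces[symmetric] by simp
    show "1 \<le> a" if "a \<in> A" for a
      using that colored_face_label_pos shifted_complexD(1)[OF \<Delta>] unfolding A_def by blast
    show "b \<in> A" if a: "a \<in> A" and b: "1 \<le> b" "b \<le> a" for a b
    proof -
      have "colored_face T"
        using a shifted_complexD(1)[OF \<Delta>] colored_face_subset unfolding A_def by blast
      then have "insert (i, b) T \<in> lowerings (insert (i, a) T)"
        using b colored_face_insert[OF _ i] unfolding lowerings_def by auto
      then show ?thesis using a shifted_complexD(3)[OF \<Delta>] unfolding A_def by blast
    qed
  qed
  moreover have "flag_f \<Delta> (insert i (color_set T)) = card A"
    unfolding flag_f_def faces using inj by (rule card_image)
  ultimately show ?thesis unfolding A_def by auto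
qed

lemma colored_complex_colored_face:
  assumes "colored_complex m \<Delta>" "F \<in> \<Delta>"
  shows "colored_face F" "color_set F \<subseteq> {1..m}"
proof -
  show colors: "color_set F \<subseteq> {1..m}"
    using assms unfolding colored_complex_def coloring_def color_set_def by blast
  have "1 \<le> a" if "(i, a) \<in> F" for i a
  proof -
    have "i \<in> {1..m}" using colors that in_color_setI by blast
    then have "{v \<in> \<Union>\<Delta>. color v = i} = {(i, a) |a. 1 \<le> a \<and> a \<le> flag_f \<Delta> {i}}"
      using assms(1) unfolding colored_complex_def by blast
    then show ?thesis using assms(2) that by auto
  qed
  moreover have "inj_on color F"
    using assms unfolding colored_complex_def coloring_def inj_on_def by blast
  ultimately show "colored_face F" unfolding colored_face_def by blast
qed

lemma color_shifted_lowerings_closed: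
  assumes \<Delta>: "colored_complex m \<Delta>" "color_shifted \<Delta>" and F: "F \<in> \<Delta>" and G: "G \<in> lowerings F"
  shows "G \<in> \<Delta>"
proof -
  obtain b where b: "G = {(i, b i) |i. i \<in> color_set G}"
    using lowerings_colored_face[OF G] by (rule colored_face_eq_graph)
  then have mem: "(i, b i) \<in> G" if "i \<in> color_set G" for i using that by blast
  then have "\<forall>i\<in>color_set G. \<exists>x\<ge>b i. (i, x) \<in> F"
    using lowerings_obtain_label[OF G] by metis
  then obtain a where a: "\<And>i. i \<in> color_set G \<Longrightarrow> b i \<le> a i \<and> (i, a i) \<in> F" by metis
  then have "{(i, a i) |i. i \<in> color_set G} \<subseteq> F" by blast
  then have "{(i, a i) |i. i \<in> color_set G} \<in> \<Delta>"
    using \<Delta>(1) F unfolding colored_complex_def simplicial_complex_def by blast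
  moreover have "\<forall>i\<in>color_set G. 1 \<le> b i \<and> b i \<le> a i"
    using a mem colored_face_label_pos[OF lowerings_colored_face[OF G]] by blast
  ultimately have "{(i, b i) |i. i \<in> color_set G} \<in> \<Delta>"
    using \<Delta>(2) unfolding color_shifted_def by blast
  with b show ?thesis by metis
qed

lemma shifted_complex_colored_complex:
  assumes \<Delta>: "shifted_complex m \<Delta>"
  shows "colored_complex m \<Delta>"
  unfolding colored_complex_def
proof (intro conjI ballI)
  have "finite F" if "F \<in> \<Delta>" for F
    using shifted_complexD(1,2)[OF \<Delta> that] finite_colored_face finite_subset by blast
  then have "finite (\<Union>\<Delta>)" using shifted_complex_finite[OF \<Delta>] by blast
  then show "simplicial_complex (\<Union>\<Delta>) \<Delta>"
    using shifted_complex_subset[OF \<Delta>] unfolding simplicial_complex_def by blast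
  have "color v \<in> {1..m}" if "F \<in> \<Delta>" "v \<in> F" for F v
    using shifted_complexD(2)[OF \<Delta>] that unfolding color_set_def by blast
  moreover have "inj_on color F" if "F \<in> \<Delta>" for F
    using shifted_complexD(1)[OF \<Delta> that] unfolding colored_face_def by blast
  ultimately show "coloring m color (\<Union>\<Delta>) \<Delta>"
    unfolding coloring_def by (blast dest: inj_onD)
  have vertex_iff: "(i, a) \<in> \<Union>\<Delta> \<longleftrightarrow> 1 \<le> a \<and> a \<le> flag_f \<Delta> {i}" for i a
  proof -
    have "(i, a) \<in> \<Union>\<Delta> \<longleftrightarrow> {(i, a)} \<in> \<Delta>" using shifted_complex_subset[OF \<Delta>] by blast
    then show ?thesis using insert_vertex_mem_iff_le_flag_f[OF \<Delta>, of i "{}"] by simp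
  qed
  show "{v \<in> \<Union>\<Delta>. color v = i} = {(i, a) |a. 1 \<le> a \<and> a \<le> flag_f \<Delta> {i}}" for i
    unfolding vertex_iff[symmetric] by auto
qed

lemma shifted_complex_color_shifted:
  assumes \<Delta>: "shifted_complex m \<Delta>"
  shows "color_shifted \<Delta>"
proof -
  have "{(i, b i) |i. i \<in> I} \<in> lowerings {(i, a i) |i. i \<in> I}"
    if "\<forall>i\<in>I. 1 \<le> b i \<and> b i \<le> a i" for I and a b :: "nat \<Rightarrow> nat"
    using that unfolding lowerings_def colored_face_def by (auto simp: inj_on_def)
  then show ?thesis using shifted_complexD(3)[OF \<Delta>] unfolding color_shifted_def by blast
qed

lemma shifted_complex_iff_color_shifted:
  "shifted_complex m \<Delta> \<longleftrightarrow> colored_complex m \<Delta> \<and> color_shifted \<Delta>"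
proof
  assume "colored_complex m \<Delta> \<and> color_shifted \<Delta>"
  then have \<Delta>: "colored_complex m \<Delta>" "color_shifted \<Delta>" by simp_all
  have "finite \<Delta>"
    using \<Delta>(1) finite_UnionD[of \<Delta>] unfolding colored_complex_def simplicial_complex_def by simp
  then show "shifted_complex m \<Delta>"
    using colored_complex_colored_face[OF \<Delta>(1)] color_shifted_lowerings_closed[OF \<Delta>]
    unfolding shifted_complex_def by auto
qed (simp add: shifted_complex_colored_complex shifted_complex_color_shifted)

lemma flag_f_eq_imp_faces_eq:
  assumes "finite \<Delta>" "flag_f \<Delta>' S = flag_f \<Delta> S" "{F \<in> \<Delta>'. color_set F = S} \<subseteq> \<Delta>"
  shows "{F \<in> \<Delta>'. color_set F = S} = {F \<in> \<Delta>. color_set F = S}"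
  using assms unfolding flag_f_def by (intro card_subset_eq) auto

locale coned_faces =
  fixes m :: nat and J :: "nat set" and base :: "nat \<Rightarrow> vertex set"
  assumes apex_colors: "J \<subseteq> {1..m}"
    and base_colors: "j \<in> J \<Longrightarrow> color_set (base j) \<subseteq> {1..m} - J"
    and base_colored_face: "j \<in> J \<Longrightarrow> colored_face (base j)"
begin

definition cone :: "nat \<Rightarrow> vertex set" where
  "cone j = insert (j, 1) (base j)"

definition cone_complex :: "vertex set set" where
  "cone_complex = (\<Union>j\<in>J. lowerings (cone j))"

lemma color_set_cone: "color_set (cone j) = insert j (color_set (base j))"
  unfolding cone_def by simp

lemma color_set_cone_subset: "j \<in> J \<Longrightarrow> color_set (cone j) \<subseteq> {1..m}"
  unfolding color_set_cone using apex_colors base_colors[of j] by blast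

lemma colored_face_cone: "j \<in> J \<Longrightarrow> colored_face (cone j)"
  unfolding cone_def using base_colors[of j] base_colored_face[of j]
  by (intro colored_face_insert) auto

lemma cone_in_cone_complex: "j \<in> J \<Longrightarrow> cone j \<in> cone_complex"
  unfolding cone_complex_def using subset_in_lowerings[OF colored_face_cone subset_refl] by blast

lemma shifted_complex_cone_complex: "shifted_complex m cone_complex"
  unfolding cone_complex_def
proof (rule shifted_complex_UN)
  show "finite J" using apex_colors finite_subset by blast
  fix j assume j: "j \<in> J"
  then have "finite (cone j)"
    using finite_colored_face[OF colored_face_cone] finite_subset[OF color_set_cone_subset] by simp
  then show "shifted_complex m (lowerings (cone j))"
    using color_set_cone_subset[OF j] by (rule shifted_complex_lowerings)
qed

lemma color_selected_cone_complex:
  "color_selected ({1..m} - J) cone_complex = (\<Union>j\<in>J. lowerings (base j))"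
proof (intro equalityI subsetI)
  fix F assume "F \<in> color_selected ({1..m} - J) cone_complex"
  then obtain j where "j \<in> J" "F \<in> lowerings (cone j)" "color_set F \<subseteq> {1..m} - J"
    unfolding color_selected_def cone_complex_def by blast
  then show "F \<in> (\<Union>j\<in>J. lowerings (base j))"
    unfolding cone_def using lowerings_insert_other_color[of j F] by blast
next
  fix F assume "F \<in> (\<Union>j\<in>J. lowerings (base j))"
  then obtain j where j: "j \<in> J" "F \<in> lowerings (base j)" by blast
  then have "F \<in> cone_complex"
    unfolding cone_complex_def cone_def using lowerings_mono[OF subset_insertI] by blast
  moreover have "color_set F \<subseteq> {1..m} - J"
    using lowerings_color_set[OF j(2)] base_colors[OF j(1)] by (rule order_trans)
  ultimately show "F \<in> color_selected ({1..m} - J) cone_complex"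
    unfolding color_selected_def by blast
qed

lemma cone_complex_apex_colorD:
  assumes "F \<in> cone_complex" "j \<in> J" "(j, a) \<in> F"
  shows "a = 1" "F \<in> lowerings (cone j)"
proof -
  obtain k where k: "k \<in> J" "F \<in> lowerings (cone k)"
    using assms(1) unfolding cone_complex_def by blast
  obtain b where b: "a \<le> b" "(j, b) \<in> cone k"
    using k(2) assms(3) by (rule lowerings_obtain_label)
  have "j \<notin> color_set (base k)" using base_colors[OF k(1)] assms(2) by blast
  then have "(j, b) = (k, 1)" using b(2) in_color_setI[of j b "base k"] unfolding cone_def by auto
  moreover have "1 \<le> a"
    using colored_face_label_pos[OF lowerings_colored_face[OF k(2)] assms(3)] .
  ultimately show "a = 1" "F \<in> lowerings (cone j)" using b(1) k(2) by auto
qed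

end

locale cone_complex_flag_f_eq = coned_faces +
  fixes \<Sigma> :: "vertex set set"
  assumes shifted: "shifted_complex m \<Sigma>"
    and flag_f_eq: "S \<subseteq> {1..m} \<Longrightarrow> flag_f \<Sigma> S = flag_f cone_complex S"
begin

lemma apex_label_eq_1:
  assumes "F \<in> \<Sigma>" "j \<in> J" "(j, a) \<in> F"
  shows "a = 1"
proof -
  have "{(j, a)} \<in> \<Sigma>" using shifted_complex_subset[OF shifted] assms(1,3) by blast
  moreover have "flag_f \<Sigma> {j} = flag_f cone_complex {j}"
    using apex_colors assms(2) by (intro flag_f_eq) blast
  ultimately have "{(j, a)} \<in> cone_complex"
    using insert_vertex_mem_iff_le_flag_f[OF shifted, of j "{}" a]
      insert_vertex_mem_iff_le_flag_f[OF shifted_complex_cone_complex, of j "{}" a]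
    by simp
  then show ?thesis using cone_complex_apex_colorD(1) assms(2) by blast
qed

lemma apex_edge_iff:
  assumes "j \<in> J" "i \<in> {1..m}" "i \<noteq> j"
  shows "{(i, a), (j, 1)} \<in> \<Sigma> \<longleftrightarrow> {(i, a), (j, 1)} \<in> cone_complex"
proof -
  have "(j, 1) \<in> F" if F: "F \<in> \<Sigma> \<or> F \<in> cone_complex" and colors: "color_set F = {i, j}" for F
  proof -
    obtain x where "(j, x) \<in> F" using colors by (blast elim: in_color_setE)
    then show ?thesis using apex_label_eq_1 cone_complex_apex_colorD(1) assms(1) F by metis
  qed
  then have "{(i, a), (j, 1)} \<in> \<Delta> \<longleftrightarrow> a \<in> {1..flag_f \<Delta> {i, j}}"
    if "\<Delta> = \<Sigma> \<or> \<Delta> = cone_complex" for \<Delta>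
    using insert_vertex_mem_iff_le_flag_f[of m \<Delta> i "{(j, 1)}" a] that assms(3)
      shifted shifted_complex_cone_complex by auto
  moreover have "flag_f \<Sigma> {i, j} = flag_f cone_complex {i, j}"
    using apex_colors assms(1,2) by (intro flag_f_eq) blast
  ultimately show ?thesis by simp
qed

lemma apex_color_face_in_lowerings_cone:
  assumes H: "H \<in> \<Sigma>" and j: "j \<in> J" "j \<in> color_set H"
  shows "H \<in> lowerings (cone j)"
proof -
  have face: "colored_face H" using shifted_complexD(1)[OF shifted H] .
  obtain x where x: "(j, x) \<in> H" using j(2) by (rule in_color_setE)
  then have apex: "(j, 1) \<in> H" using apex_label_eq_1[OF H j(1) x] by simp
  have "\<exists>b\<ge>a. (i, b) \<in> cone j" if v: "(i, a) \<in> H" for i a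
  proof (cases "i = j")
    case True
    then show ?thesis
      using colored_face_label_unique[OF face, of j a 1] v apex unfolding cone_def by auto
  next
    case False
    have "i \<in> {1..m}" using shifted_complexD(2)[OF shifted H] in_color_setI[OF v] by blast
    moreover have "{(i, a), (j, 1)} \<in> \<Sigma>"
      using v apex by (intro shifted_complex_subset[OF shifted H]) simp
    ultimately have "{(i, a), (j, 1)} \<in> cone_complex"
      using apex_edge_iff[OF j(1) _ False] by simp
    then have "{(i, a), (j, 1)} \<in> lowerings (cone j)"
      using cone_complex_apex_colorD(2)[OF _ j(1)] by blast
    then obtain b where "a \<le> b" "(i, b) \<in> cone j"
      using insertI1 by (rule lowerings_obtain_label)
    then show ?thesis by blast
  qed
  then show ?thesis using face unfolding lowerings_def by auto
qed

lemma cone_mem: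
  assumes j: "j \<in> J"
  shows "cone j \<in> \<Sigma>"
proof -
  let ?S = "color_set (cone j)"
  have "{F \<in> \<Sigma>. color_set F = ?S} \<subseteq> cone_complex"
    using apex_color_face_in_lowerings_cone[OF _ j] j color_set_cone
    unfolding cone_complex_def by blast
  then have "{F \<in> \<Sigma>. color_set F = ?S} = {F \<in> cone_complex. color_set F = ?S}"
    using shifted_complex_finite[OF shifted_complex_cone_complex]
      flag_f_eq[OF color_set_cone_subset[OF j]]
    by (intro flag_f_eq_imp_faces_eq)
  then show ?thesis using cone_in_cone_complex[OF j] by blast
qed

lemma eq_cone_complex: "\<Sigma> = cone_complex"
proof
  show sub: "cone_complex \<subseteq> \<Sigma>"
    unfolding cone_complex_def using cone_mem shifted_complexD(3)[OF shifted] by blast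
  show "\<Sigma> \<subseteq> cone_complex"
  proof
    fix F assume F: "F \<in> \<Sigma>"
    have "flag_f \<Sigma> (color_set F) = flag_f cone_complex (color_set F)"
      using shifted_complexD(2)[OF shifted F] by (rule flag_f_eq)
    then have "{G \<in> cone_complex. color_set G = color_set F} = {G \<in> \<Sigma>. color_set G = color_set F}"
      using sub shifted_complex_finite[OF shifted] by (intro flag_f_eq_imp_faces_eq) auto
    then show "F \<in> cone_complex" using F by blast
  qed
qed

end

lemma (in coned_faces) cone_complex_unique:
  assumes "shifted_complex m \<Sigma>"
    and "\<And>S. S \<subseteq> {1..m} \<Longrightarrow> flag_f \<Sigma> S = flag_f cone_complex S"
  shows "\<Sigma> = cone_complex"
proof -
  interpret cone_complex_flag_f_eq m J base \<Sigma> using assms by unfold_locales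
  show ?thesis by (rule eq_cone_complex)
qed

lemma coned_faces_new_colors:
  assumes \<Delta>: "shifted_complex n \<Delta>" and mem: "\<And>j. j \<in> {n<..m} \<Longrightarrow> base j \<in> \<Delta>"
  shows "coned_faces m {n<..m} base"
proof
  show "{n<..m} \<subseteq> {1..m}" by auto
  fix j assume j: "j \<in> {n<..m}"
  then have "{1..n} \<subseteq> {1..m} - {n<..m}" by auto
  with shifted_complexD(2)[OF \<Delta> mem[OF j]] show "color_set (base j) \<subseteq> {1..m} - {n<..m}"
    by (rule order_trans)
  show "colored_face (base j)" using shifted_complexD(1)[OF \<Delta> mem[OF j]] .
qed

theorem theorem2:
  fixes n :: nat and \<Delta> :: "vertex set set"
  assumes "n \<ge> 1"
    and "colored_complex n \<Delta>"
    and "color_shifted \<Delta>"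
  shows "\<exists>m \<Gamma>. n \<le> m \<and> colored_complex m \<Gamma> \<and>
           color_selected {1..n} \<Gamma> = \<Delta> \<and>
           color_shifted \<Gamma> \<and>
           (\<forall>\<Sigma>. colored_complex m \<Sigma> \<and> color_shifted \<Sigma> \<and>
                 (\<forall>S. S \<subseteq> {1..m} \<longrightarrow> flag_f \<Sigma> S = flag_f \<Gamma> S) \<longrightarrow> \<Sigma> = \<Gamma>)"
proof -
  have \<Delta>: "shifted_complex n \<Delta>" using assms(2,3) shifted_complex_iff_color_shifted by blast
  define m where "m = n + card \<Delta>"
  then have "n \<le> m" "card {n<..m} = card \<Delta>" by simp_all
  then obtain face where face: "face ` {n<..m} = \<Delta>"
    using finite_same_card_bij[of "{n<..m}" \<Delta>] shifted_complex_finite[OF \<Delta>]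
    by (auto simp: bij_betw_def)
  interpret coned_faces m "{n<..m}" face
    using \<Delta> by (rule coned_faces_new_colors) (use face in blast)
  have "{1..m} - {n<..m} = {1..n}" using \<open>n \<le> m\<close> by auto
  then have "color_selected {1..n} cone_complex = (\<Union>F\<in>face ` {n<..m}. lowerings F)"
    using color_selected_cone_complex by simp
  also have "\<dots> = \<Delta>" unfolding face by (rule shifted_complex_UN_lowerings[OF \<Delta>])
  finally have "color_selected {1..n} cone_complex = \<Delta>" .
  then show ?thesis
    using \<open>n \<le> m\<close> shifted_complex_cone_complex cone_complex_unique
    unfolding shifted_complex_iff_color_shifted by metis
qed

end
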